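(* Let $\mathbb{F}_q$ be a finite field with $q$ elements, let $d \ge 1$ be an integer, let $0 \le \alpha \le d$, and let $C_{geom}, C_{size} > 0$. Let $E \subset \mathbb{F}_q^d$ be such that $$|E \cap l_y| \le C_{geom}\, q^{\frac{\alpha}{d}}$$ for every $y \in \mathbb{F}_q^d$ with $y \neq (0,\dots,0)$, where $l_y = \{ty : t \in \mathbb{F}_q\}$. Suppose that $$|E| \ge C_{size}\, q^{\frac{d}{2}+\frac{\alpha}{2d}}.$$ Then $$|\{x\cdot y : x,y \in E\}| \ge q \cdot \frac{C_{size}^2}{C_{size}^2 + C_{geom}}.$$
   Context: For $x=(x_1,\dots,x_d), y=(y_1,\dots,y_d) \in \mathbb{F}_q^d$, $x\cdot y = x_1y_1+\dots+x_dy_d$. *)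

theory Defs
  imports "HOL-Analysis.Finite_Cartesian_Product"
begin

text \<open>
  \<open>\<F>\<^sub>q\<^sup>d\<close> is rendered as \<open>'a ^ 'd\<close> with \<open>'a\<close> a finite field, so that \<open>q = CARD('a)\<close> and
  \<open>d = CARD('d) \<ge> 1\<close>.  The inner product of \<open>HOL-Analysis\<close> is available only for real inner
  product spaces, hence the dot product over an arbitrary coefficient ring here.
\<close>

definition dot_prod :: "'a::comm_semiring_1 ^ 'd \<Rightarrow> 'a ^ 'd \<Rightarrow> 'a" where
  "dot_prod x y = (\<Sum>i\<in>UNIV. x $ i * y $ i)"

definition origin_line :: "'a::comm_semiring_1 ^ 'd \<Rightarrow> ('a ^ 'd) set" where
  "origin_line y = {t *s y | t. True}"

definition dot_product_set :: "('a::comm_semiring_1 ^ 'd) set \<Rightarrow> 'a set" where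
  "dot_product_set E = {dot_prod x y | x y. x \<in> E \<and> y \<in> E}"

end

theory Submission
  imports Defs "HOL-Analysis.Convex"
begin

text \<open>
  For \<open>x\<close> put \<open>c x = |{(y, y') \<in> E\<^sup>2. x \<bullet> y = x \<bullet> y'}|\<close>. By Cauchy--Schwarz
  \<open>|E|\<^sup>2 \<le> |x \<bullet> E| * c x\<close>, so it suffices to bound \<open>c\<close> on average over the nonzero points of
  \<open>E\<close>. The excess \<open>c x - |E|\<^sup>2 / q\<close> is nonnegative, is constant along punctured lines through the
  origin, and its sum over all \<open>x\<close> is known exactly by counting points on hyperplanes. Hence, since
  \<open>E\<close> has few points on each line, its sum over \<open>E\<close> is small.

  If \<open>0 \<in> E\<close>, then \<open>x\<close> ranges only over \<open>E - {0}\<close> while \<open>y\<close> still ranges over \<open>E\<close>; the lost point is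
  compensated by the bound \<open>K\<close> for the points on a line improving to \<open>K - 1\<close>, provided that
  \<open>K \<le> |E|\<close>. Otherwise the trivial bound \<open>|x \<bullet> E| \<ge> |E| / q\<^bsup>d - 1\<^esup>\<close> is good enough.
\<close>

declare CARD_vec [simp del]

section \<open>Algebra of the dot product\<close>

lemma dot_prod_diff_right:
  fixes x :: "'a::comm_ring_1 ^ 'd"
  shows "dot_prod x (y - z) = dot_prod x y - dot_prod x z"
  by (simp add: dot_prod_def right_diff_distrib sum_subtractf)

lemma dot_prod_diff_left:
  fixes x :: "'a::comm_ring_1 ^ 'd"
  shows "dot_prod (x - y) z = dot_prod x z - dot_prod y z"
  by (simp add: dot_prod_def left_diff_distrib sum_subtractf)

lemma dot_prod_add_left: "dot_prod (x + y) z = dot_prod x z + dot_prod y z"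
  by (simp add: dot_prod_def distrib_right sum.distrib)

lemma dot_prod_smult_left: "dot_prod (c *s x) y = c * dot_prod x y"
  by (simp add: dot_prod_def sum_distrib_left mult.assoc)

lemma dot_prod_commute: "dot_prod x y = dot_prod y x"
  by (simp add: dot_prod_def mult.commute)

lemma dot_prod_axis: "dot_prod (axis i c) x = c * x $ i"
  by (simp add: dot_prod_def axis_def if_distrib if_distribR cong: if_cong)

section \<open>Collision counts and hyperplanes\<close>

text \<open>This is the second moment of the fibre sizes of \<open>g\<close> on \<open>A\<close>;
  diagonal pairs are included.\<close>

definition collisions :: "('b \<Rightarrow> 'c) \<Rightarrow> 'b set \<Rightarrow> nat" where
  "collisions g A = (\<Sum>a\<in>A. card {b \<in> A. g b = g a})"

lemma card_squared_le_collisions: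
  assumes "finite A"
  shows "(card A)\<^sup>2 \<le> card (g ` A) * collisions g A"
proof -
  let ?c = "\<lambda>t. card {b \<in> A. g b = t}"
  have 1: "card A = (\<Sum>t\<in>g ` A. ?c t)"
    using sum.image_gen[OF assms, of "\<lambda>_. 1::nat" g] by simp
  \<comment> \<open>A fibre of size \<open>k\<close> contributes \<open>k\<close> summands equal to
    \<open>k\<close>.\<close>
  have 2: "collisions g A = (\<Sum>t\<in>g ` A. (?c t)\<^sup>2)"
    unfolding collisions_def
    by (subst sum.image_gen[OF assms, of _ g]) (simp add: power2_eq_square)
  have "(\<Sum>t\<in>g ` A. real (?c t))\<^sup>2 \<le> (\<Sum>t\<in>g ` A. (real (?c t))\<^sup>2) * card (g ` A)"
    by (rule sum_squared_le_sum_of_squares)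
  then have "real ((card A)\<^sup>2) \<le> real (card (g ` A) * collisions g A)"
    unfolding 1 2 by (simp add: mult.commute)
  then show ?thesis by (simp only: of_nat_le_iff)
qed

text \<open>Translation along an axis \<open>i\<close> with \<open>w $ i\<close> nonzero shifts
  \<open>dot_prod v w\<close> by any prescribed amount, so all \<open>CARD('a)\<close> fibres have
  the same size.\<close>

lemma card_hyperplane:
  fixes w :: "'a::{field,finite} ^ 'd"
  assumes "w \<noteq> 0"
  shows "CARD('a) * card {v. dot_prod v w = c} = CARD('a ^ 'd)"
proof -
  obtain i where i: "w $ i \<noteq> 0" using assms by (auto simp: vec_eq_iff)
  have eq: "card {v. dot_prod v w = t} = card {v. dot_prod v w = c}" for t
    by (rule bij_betw_same_card[where f = "\<lambda>v. v + axis i ((c - t) / w $ i)"],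
        rule bij_betwI[where g = "\<lambda>v. v - axis i ((c - t) / w $ i)"])
      (use i in \<open>auto simp: dot_prod_add_left dot_prod_diff_left dot_prod_axis\<close>)
  have "CARD('a ^ 'd) = (\<Sum>t\<in>UNIV. card {v. dot_prod v w = t})"
    using sum.group[of "UNIV :: ('a^'d) set" "UNIV :: 'a set" "\<lambda>v. dot_prod v w" "\<lambda>_. 1::nat"]
    by simp
  also have "\<dots> = CARD('a) * card {v. dot_prod v w = c}"
    by (subst sum.cong[OF refl eq]) simp
  finally show ?thesis by simp
qed

text \<open>Swap the sums: a diagonal pair collides for every \<open>v\<close>, any other pair
  exactly for the \<open>v\<close> on the hyperplane orthogonal to its difference.\<close>

lemma sum_collisions:
  fixes E :: "('a::{field,finite} ^ 'd) set"
  shows "(\<Sum>v\<in>UNIV. real (collisions (dot_prod v) E)) =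
    real (card E) * CARD('a ^ 'd) * (1 + (real (card E) - 1) / CARD('a))"
proof -
  let ?N = "real CARD('a ^ 'd)" and ?q = "real CARD('a)"
  have fib: "real (card {v. dot_prod v b = dot_prod v a}) = (if b = a then ?N else ?N / ?q)"
    for a b :: "'a ^ 'd"
  proof (cases "b = a")
    case False
    have "{v. dot_prod v b = dot_prod v a} = {v. dot_prod v (b - a) = 0}"
      by (simp add: dot_prod_diff_right)
    then have "CARD('a) * card {v. dot_prod v b = dot_prod v a} = CARD('a ^ 'd)"
      using card_hyperplane[of "b - a" 0] False by simp
    then have "?q * real (card {v. dot_prod v b = dot_prod v a}) = ?N"
      by (metis of_nat_mult)
    then show ?thesis using False by (simp add: field_simps)
  qed simp
  have "(\<Sum>v\<in>UNIV. real (collisions (dot_prod v) E)) =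
      (\<Sum>v\<in>UNIV. \<Sum>a\<in>E. \<Sum>b\<in>E. of_bool (dot_prod v b = dot_prod v a))"
    by (simp add: collisions_def sum.If_cases of_bool_def Int_def conj_commute)
  also have "\<dots> = (\<Sum>a\<in>E. \<Sum>b\<in>E. \<Sum>v\<in>UNIV. of_bool (dot_prod v b = dot_prod v a))"
    by (subst sum.swap, rule sum.cong[OF refl], rule sum.swap)
  also have "\<dots> = (\<Sum>a\<in>E. \<Sum>b\<in>E. if b = a then ?N else ?N / ?q)"
    by (simp flip: fib add: sum.If_cases of_bool_def)
  also have "\<dots> = (\<Sum>a\<in>E. ?N + (real (card E) - 1) * (?N / ?q))"
  proof (rule sum.cong[OF refl])
    fix a assume a: "a \<in> E"
    have "card E > 0" using a by (auto simp: card_gt_0_iff)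
    then show "(\<Sum>b\<in>E. if b = a then ?N else ?N / ?q) = ?N + (real (card E) - 1) * (?N / ?q)"
      using a by (subst sum.remove[of _ a]) (auto simp: card_Diff_singleton)
  qed
  finally show ?thesis by (simp add: algebra_simps)
qed

section \<open>Averaging over lines through the origin\<close>

lemma collisions_dot_prod_smult:
  fixes v :: "'a::field ^ 'd"
  assumes "s \<noteq> 0"
  shows "collisions (dot_prod (s *s v)) E = collisions (dot_prod v) E"
  using assms by (simp add: collisions_def dot_prod_smult_left)

lemma card_smult_in_eq:
  fixes v :: "'a::{field,finite} ^ 'd"
  assumes "v \<noteq> 0"
  shows "card {s. s *s v \<in> A} = card (A \<inter> origin_line v)"
proof (rule bij_betw_same_card[of "\<lambda>s. s *s v"])
  show "bij_betw (\<lambda>s. s *s v) {s. s *s v \<in> A} (A \<inter> origin_line v)"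
    using assms by (auto simp: bij_betw_def inj_on_def origin_line_def)
qed

text \<open>Replacing \<open>A\<close> by its dilates does not change the sum of a homogeneous \<open>h\<close>; averaging over
  the \<open>q - 1\<close> dilates, every point \<open>v\<close> is hit as often as \<open>A\<close> meets the line through \<open>v\<close>.\<close>
lemma sum_homogeneous_le:
  fixes h :: "'a::{field,finite} ^ 'd \<Rightarrow> real"
  assumes nonneg: "\<And>v. h v \<ge> 0"
    and hom: "\<And>s v. s \<noteq> 0 \<Longrightarrow> h (s *s v) = h v"
    and "0 \<notin> A"
    and line: "\<And>v. v \<noteq> 0 \<Longrightarrow> real (card (A \<inter> origin_line v)) \<le> L"
    and "L \<ge> 0"
  shows "(real CARD('a) - 1) * (\<Sum>x\<in>A. h x) \<le> L * (\<Sum>v\<in>UNIV. h v)"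
proof -
  have *: "(\<Sum>x\<in>A. h x) = (\<Sum>v\<in>UNIV. of_bool (s *s v \<in> A) * h v)" if "s \<noteq> 0" for s
  proof -
    have "(\<Sum>x\<in>A. h x) = (\<Sum>x\<in>UNIV. of_bool (x \<in> A) * h x)"
      by (rule sum.mono_neutral_cong_left) auto
    also have "\<dots> = (\<Sum>v\<in>UNIV. of_bool (s *s v \<in> A) * h (s *s v))"
      by (rule sum.reindex_bij_witness[where i = "\<lambda>v. s *s v" and j = "\<lambda>v. inverse s *s v"])
        (use that in \<open>auto simp: vector_smult_assoc\<close>)
    finally show ?thesis by (simp add: hom that)
  qed
  have "(real CARD('a) - 1) * (\<Sum>x\<in>A. h x) = (\<Sum>s\<in>UNIV - {0::'a}. \<Sum>x\<in>A. h x)"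
    by (simp add: card_Diff_singleton of_nat_diff Suc_leI)
  also have "\<dots> = (\<Sum>s\<in>UNIV - {0::'a}. \<Sum>v\<in>UNIV. of_bool (s *s v \<in> A) * h v)"
    by (rule sum.cong[OF refl]) (use * in blast)
  \<comment> \<open>Admitting \<open>s = 0\<close> only adds nonnegative terms and lets
    \<open>s\<close> parametrize the full line.\<close>
  also have "\<dots> \<le> (\<Sum>s\<in>UNIV. \<Sum>v\<in>UNIV. of_bool (s *s v \<in> A) * h v)"
    by (rule sum_mono2) (auto intro!: sum_nonneg nonneg)
  also have "\<dots> = (\<Sum>v\<in>UNIV. real (card {s. s *s v \<in> A}) * h v)"
    by (subst sum.swap) (simp flip: sum_distrib_right add: sum.If_cases of_bool_def)
  also have "\<dots> \<le> (\<Sum>v\<in>UNIV. L * h v)"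
  proof (rule sum_mono, rule mult_right_mono[OF _ nonneg])
    fix v :: "'a ^ 'd"
    show "real (card {s. s *s v \<in> A}) \<le> L"
    \<comment> \<open>At \<open>v = 0\<close> the count is 0, because the origin is not in
      \<open>A\<close>.\<close>
    proof (cases "v = 0")
      case True
      then show ?thesis using assms(3,5) by simp
    next
      case False
      then show ?thesis using line card_smult_in_eq[of v A] by simp
    qed
  qed
  finally show ?thesis by (simp only: sum_distrib_left[symmetric])
qed

section \<open>Lower bounds for the dot product set\<close>

lemma dot_prod_image_subset: "x \<in> E \<Longrightarrow> dot_prod x ` E \<subseteq> dot_product_set E"
  by (auto simp: dot_product_set_def)

lemma one_less_card_field: "1 < CARD('a::{field,finite})"
proof -
  have "card {0, 1::'a} \<le> CARD('a)" by (rule card_mono) auto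
  then show ?thesis by simp
qed

text \<open>Averaging over lines requires a set without the origin, so the first factor runs over
  \<open>E - {0}\<close> and the second over all of \<open>E\<close>; hence the mixed product
  \<open>m * n\<close>.\<close>

lemma dot_product_set_estimate:
  fixes E :: "('a::{field,finite} ^ 'd) set"
    and L m n :: real
  assumes line: "\<And>v. v \<noteq> 0 \<Longrightarrow> real (card ((E - {0}) \<inter> origin_line v)) \<le> L"
    and "L \<ge> 0"
  defines "m \<equiv> real (card (E - {0}))" and "n \<equiv> real (card E)"
  shows "real CARD('a) * m * n \<le> card (dot_product_set E) * (m * n + L * CARD('a ^ 'd))"
proof (cases "n = 0")
  case False
  define q N P where "q = real CARD('a)" and "N = real CARD('a ^ 'd)"
    and "P = real (card (dot_product_set E))"
  define c where "c = (\<lambda>v. real (collisions (dot_prod v) E))"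
  have q: "q > 1" using one_less_card_field[where 'a='a] by (simp add: q_def)
  have n: "n > 0" using False by (simp add: n_def card_gt_0_iff)
  have cs: "n\<^sup>2 \<le> real (card (dot_prod v ` E)) * c v" for v
    using card_squared_le_collisions[of E "dot_prod v"]
    by (simp add: n_def c_def flip: of_nat_mult of_nat_power)
  have c0: "c v \<ge> 0" for v by (simp add: c_def)
  have nonneg: "0 \<le> c v - n\<^sup>2 / q" for v
  proof -
    \<comment> \<open>A dot product takes at most \<open>q\<close> values.\<close>
    have "n\<^sup>2 \<le> q * c v"
      by (rule order.trans[OF cs mult_right_mono[OF _ c0]]) (simp add: q_def card_mono)
    then show ?thesis using q by (simp add: field_simps)
  qed
  \<comment> \<open>The factor \<open>q - 1\<close> appearing here cancels the number of dilates in
    the averaging bound.\<close>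
  have "(\<Sum>v\<in>UNIV. c v - n\<^sup>2 / q) = (q - 1) * (n * N / q)"
    using q sum_collisions[of E]
    by (simp add: sum_subtractf c_def flip: N_def n_def q_def)
      (simp add: field_simps power2_eq_square)
  moreover have "(q - 1) * (\<Sum>x\<in>E - {0}. c x - n\<^sup>2 / q) \<le> L * (\<Sum>v\<in>UNIV. c v - n\<^sup>2 / q)"
    unfolding q_def
    by (rule sum_homogeneous_le)
      (use nonneg line \<open>L \<ge> 0\<close> in \<open>auto simp: c_def q_def collisions_dot_prod_smult\<close>)
  ultimately have "(q - 1) * (\<Sum>x\<in>E - {0}. c x - n\<^sup>2 / q) \<le> (q - 1) * (L * n * N / q)"
    by (simp add: mult.left_commute mult.assoc)
  then have "(\<Sum>x\<in>E - {0}. c x - n\<^sup>2 / q) \<le> L * n * N / q"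
    by (rule mult_left_le_imp_le) (use q in simp)
  then have "(\<Sum>x\<in>E - {0}. c x) \<le> (m * n\<^sup>2 + L * n * N) / q"
    by (simp add: sum_subtractf add_divide_distrib flip: m_def)
  then have S: "q * (\<Sum>x\<in>E - {0}. c x) \<le> n * (m * n + L * N)"
    using q by (simp add: pos_le_divide_eq algebra_simps power2_eq_square)
  \<comment> \<open>For \<open>x\<close> in \<open>E\<close> the values lie in the dot product set,
    so \<open>P\<close> replaces \<open>q\<close> in Cauchy-Schwarz.\<close>
  have "n\<^sup>2 \<le> P * c x" if "x \<in> E - {0}" for x
    by (rule order.trans[OF cs mult_right_mono[OF _ c0]])
      (use that dot_prod_image_subset[of x E] in \<open>simp add: P_def card_mono\<close>)
  then have "(\<Sum>x\<in>E - {0}. n\<^sup>2) \<le> (\<Sum>x\<in>E - {0}. P * c x)"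
    by (rule sum_mono)
  then have "m * n\<^sup>2 \<le> P * (\<Sum>x\<in>E - {0}. c x)"
    by (simp add: sum_distrib_left flip: m_def)
  then have "q * (m * n\<^sup>2) \<le> P * (q * (\<Sum>x\<in>E - {0}. c x))"
    using q by (simp add: mult.left_commute)
  also have "\<dots> \<le> P * (n * (m * n + L * N))"
    by (rule mult_left_mono[OF S]) (simp add: P_def)
  finally have "n * (q * m * n) \<le> n * (P * (m * n + L * N))"
    by (simp add: power2_eq_square mult_ac)
  then show ?thesis
    using n by (simp add: q_def N_def P_def)
next
  case True
  then show ?thesis using \<open>L \<ge> 0\<close> by (auto intro!: mult_nonneg_nonneg)
qed

text \<open>One nonzero \<open>x\<close> suffices: the fibres of \<open>dot_prod x\<close> cover
  \<open>E\<close>, and each lies in a hyperplane.\<close>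

lemma card_le_dot_product_set:
  fixes E :: "('a::{field,finite} ^ 'd) set"
  assumes "x \<in> E" "x \<noteq> 0"
  shows "CARD('a) * card E \<le> card (dot_product_set E) * CARD('a ^ 'd)"
proof -
  have "card E = (\<Sum>t\<in>dot_prod x ` E. card {y \<in> E. dot_prod x y = t})"
    using sum.image_gen[of E "\<lambda>_. 1::nat" "dot_prod x"] by simp
  then have "CARD('a) * card E = (\<Sum>t\<in>dot_prod x ` E. CARD('a) * card {y \<in> E. dot_prod x y = t})"
    by (simp add: sum_distrib_left)
  also have "\<dots> \<le> (\<Sum>t\<in>dot_prod x ` E. CARD('a ^ 'd))"
  proof (rule sum_mono)
    fix t
    have "CARD('a) * card {y \<in> E. dot_prod x y = t} \<le> CARD('a) * card {y. dot_prod y x = t}"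
      by (intro mult_left_mono card_mono) (auto simp: dot_prod_commute)
    then show "CARD('a) * card {y \<in> E. dot_prod x y = t} \<le> CARD('a ^ 'd)"
      using card_hyperplane[OF assms(2), of t] by simp
  qed
  also have "\<dots> \<le> card (dot_product_set E) * CARD('a ^ 'd)"
    using dot_prod_image_subset[OF assms(1)] by (simp add: card_mono)
  finally show ?thesis .
qed

lemma card_dot_product_set_ge:
  fixes E :: "('a::{field,finite} ^ 'd) set"
    and K :: real
  assumes line: "\<And>y. y \<noteq> 0 \<Longrightarrow> real (card (E \<inter> origin_line y)) \<le> K"
    and "E \<noteq> {}" and "K > 0"
  shows "real CARD('a) * (real (card E))\<^sup>2
    \<le> card (dot_product_set E) * ((real (card E))\<^sup>2 + K * CARD('a ^ 'd))"
proof -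
  define q N P n where "q = real CARD('a)" and "N = real CARD('a ^ 'd)"
    and "P = real (card (dot_product_set E))" and "n = real (card E)"
  have n: "n \<ge> 1" using assms(2) by (simp add: n_def Suc_le_eq card_gt_0_iff)
  have q: "q > 1" using one_less_card_field[where 'a='a] by (simp add: q_def)
  have N: "N \<ge> q"
  proof -
    have "CARD('a) ^ 1 \<le> CARD('a) ^ CARD('d)"
      by (rule power_increasing) (auto simp: Suc_leI)
    then show ?thesis unfolding N_def q_def CARD_vec by simp
  qed
  have "dot_product_set E \<noteq> {}" using assms(2) by (auto simp: dot_product_set_def)
  then have P: "P \<ge> 1" by (simp add: P_def Suc_le_eq card_gt_0_iff)
  consider "0 \<notin> E" | "0 \<in> E" "K < n" | "n \<le> K" by linarith
  then have "q * n\<^sup>2 \<le> P * (n\<^sup>2 + K * N)"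
  proof cases
    case 1
    then have "E - {0} = E" by simp
    then show ?thesis
      using dot_product_set_estimate[of E K] line \<open>K > 0\<close>
      by (simp add: q_def N_def P_def n_def power2_eq_square mult.assoc)
  next
    case 2
    have card_E: "real (card (E - {0})) = n - 1"
      using 2 n by (simp add: n_def card_Diff_singleton)
    have line': "real (card ((E - {0}) \<inter> origin_line v)) \<le> K - 1" if "v \<noteq> 0" for v
    proof -
      \<comment> \<open>The origin lies on every line, so deleting it lowers each count by exactly
        one.\<close>
      have 0: "0 \<in> E \<inter> origin_line v"
        using 2 by (auto simp: origin_line_def intro: exI[of _ 0])
      have "(E - {0}) \<inter> origin_line v = (E \<inter> origin_line v) - {0}" by blast
      then have "card (E \<inter> origin_line v) = Suc (card ((E - {0}) \<inter> origin_line v))"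
        using card.remove[OF _ 0] by simp
      then show ?thesis using line[OF that] by simp
    qed
    have K: "K \<ge> 1"
      \<comment> \<open>Any nonzero vector would do: the count on its line is nonnegative and at
        most \<open>K - 1\<close>.\<close>
      using order.trans[OF of_nat_0_le_iff line'[of "axis undefined 1"]] by simp
    have est: "q * (n - 1) * n \<le> P * ((n - 1) * n + (K - 1) * N)"
      using dot_product_set_estimate[of E "K - 1", OF line'] K
      unfolding card_E by (simp add: q_def N_def P_def n_def)
    have "(n - 1) * (q * n\<^sup>2) = n * (q * (n - 1) * n)"
      by (simp add: power2_eq_square)
    also have "\<dots> \<le> n * (P * ((n - 1) * n + (K - 1) * N))"
      using est n by simp
    \<comment> \<open>Passing from \<open>n - 1\<close> and \<open>K - 1\<close> to \<open>n\<close>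
      and \<open>K\<close> leaves exactly the slack \<open>P * N * (n - K)\<close>, nonnegative as
      \<open>K < n\<close>. Afterwards \<open>n - 1\<close> cancels, since
      \<open>n > K \<ge> 1\<close>.\<close>
    also have "\<dots> = (n - 1) * (P * (n\<^sup>2 + K * N)) - P * N * (n - K)"
      by (simp add: algebra_simps power2_eq_square)
    also have "\<dots> \<le> (n - 1) * (P * (n\<^sup>2 + K * N))"
      using 2 P N q by simp
    finally show ?thesis using K 2 by simp
  next
    case 3
    have "q * n \<le> P * N"
    proof (cases "E \<subseteq> {0}")
      case True
      \<comment> \<open>Here \<open>E = {0}\<close>, and \<open>P \<ge> 1\<close> together with
        \<open>N \<ge> q\<close> is enough.\<close>
      then have "n = 1" using assms(2) by (auto simp: n_def subset_singleton_iff)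
      then show ?thesis using N P q mult_mono[of 1 P q N] by simp
    next
      case False
      then obtain x where "x \<in> E" "x \<noteq> 0" by blast
      from card_le_dot_product_set[OF this] show ?thesis
        by (simp add: q_def N_def P_def n_def flip: of_nat_mult)
    qed
    then have "n * (q * n) \<le> K * (P * N)"
      using 3 n q \<open>K > 0\<close> by (intro mult_mono[of n K]) auto
    also have "\<dots> \<le> P * (n\<^sup>2 + K * N)"
      using P by (simp add: algebra_simps)
    finally show ?thesis by (simp add: power2_eq_square mult_ac)
  qed
  then show ?thesis by (simp add: q_def N_def P_def n_def)
qed

section \<open>From the bound in \<open>K\<close> to the constants \<open>C_geom\<close> and
  \<open>C_size\<close>\<close>

theorem theorem1p4:
  fixes E :: "('a::{field,finite} ^ 'd) set"
    and \<alpha> C_geom C_size :: real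
  assumes "0 \<le> \<alpha>" and "\<alpha> \<le> real CARD('d)"
    and "C_geom > 0" and "C_size > 0"
    and "\<And>y. y \<noteq> 0 \<Longrightarrow>
      real (card (E \<inter> origin_line y)) \<le> C_geom * real CARD('a) powr (\<alpha> / real CARD('d))"
    and "real (card E) \<ge>
      C_size * real CARD('a) powr (real CARD('d) / 2 + \<alpha> / (2 * real CARD('d)))"
  shows "real (card (dot_product_set E)) \<ge> real CARD('a) * (C_size\<^sup>2 / (C_size\<^sup>2 + C_geom))"
proof -
  define q d n P where "q = real CARD('a)" and "d = real CARD('d)"
    and "n = real (card E)" and "P = real (card (dot_product_set E))"
  define K where "K = C_geom * q powr (\<alpha> / d)"
  have q: "q > 1" using one_less_card_field[where 'a='a] by (simp add: q_def)
  have K: "K > 0" using q assms(3) by (simp add: K_def)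
  have N: "real CARD('a ^ 'd) = q powr d"
    using q by (simp add: CARD_vec q_def d_def powr_realpow)
  have size: "C_size * q powr (d / 2 + \<alpha> / (2 * d)) \<le> n"
    using assms(6) by (simp add: q_def d_def n_def)
  have n: "n > 0"
    by (rule less_le_trans[OF _ size]) (use q assms(4) in simp)
  then have "E \<noteq> {}" by (auto simp: n_def)
  with assms(5) K have est: "q * n\<^sup>2 \<le> P * (n\<^sup>2 + K * q powr d)"
    using card_dot_product_set_ge[of E K] by (simp add: q_def d_def n_def P_def K_def N)
  \<comment> \<open>Squaring doubles the exponent to \<open>d + \<alpha> / d\<close>, that of
    \<open>K * q powr d\<close>; the error term is thus at most
    \<open>C_geom / C_size\<^sup>2\<close> times \<open>n\<^sup>2\<close>.\<close>
  have "(C_size * q powr (d / 2 + \<alpha> / (2 * d)))\<^sup>2 \<le> n\<^sup>2"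
    by (rule power_mono[OF size]) (use q assms(4) in simp)
  moreover have "(q powr (d / 2 + \<alpha> / (2 * d)))\<^sup>2 = q powr (\<alpha> / d) * q powr d"
    by (simp add: power2_eq_square add.commute flip: powr_add)
  ultimately have "C_size\<^sup>2 * (q powr (\<alpha> / d) * q powr d) \<le> n\<^sup>2"
    by (simp add: power_mult_distrib)
  then have "C_geom * (C_size\<^sup>2 * (q powr (\<alpha> / d) * q powr d)) \<le> C_geom * n\<^sup>2"
    using assms(3) by simp
  then have *: "C_size\<^sup>2 * (K * q powr d) \<le> C_geom * n\<^sup>2"
    by (simp add: K_def mult_ac)
  have "n\<^sup>2 * (q * C_size\<^sup>2) = C_size\<^sup>2 * (q * n\<^sup>2)" by simp
  also have "\<dots> \<le> C_size\<^sup>2 * (P * (n\<^sup>2 + K * q powr d))"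
    by (rule mult_left_mono[OF est]) simp
  also have "\<dots> = P * (C_size\<^sup>2 * n\<^sup>2 + C_size\<^sup>2 * (K * q powr d))"
    by (simp add: algebra_simps)
  also have "\<dots> \<le> P * (C_size\<^sup>2 * n\<^sup>2 + C_geom * n\<^sup>2)"
    using * by (intro mult_left_mono add_left_mono) (auto simp: P_def)
  also have "\<dots> = n\<^sup>2 * (P * (C_size\<^sup>2 + C_geom))"
    by (simp add: algebra_simps)
  finally have "q * C_size\<^sup>2 \<le> P * (C_size\<^sup>2 + C_geom)"
    using n by simp
  moreover have "C_size\<^sup>2 + C_geom > 0"
    using assms(3) by (simp add: add_nonneg_pos)
  ultimately show ?thesis
    by (simp add: pos_divide_le_eq flip: q_def P_def)
qed

end
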